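(* Let $X$ be a partially ordered normed space whose ordering cone $\mathcal{C}$ is closed, convex and pointed, let $x_0\in A\subset X$, $\varepsilon\ge0$, and $D\in\overline{\mathcal{H}}$. Assume that $(-\mathcal{C},\ \overline{\mathrm{cone}}(A-x_0+D(\varepsilon)))$ has the strict separation property (SSP) and that $\mathcal{S}(D(\varepsilon),x_0)\neq\emptyset$. Then $x_0\in\mathrm{He}(A,\mathcal{C},D,\varepsilon)$ if and only if there exists $(f,\alpha)\in\mathcal{C}^{a\#}_+$ such that $\min_{x\in(A+D(\varepsilon))\cup\{x_0\}}\ f(x-x_0)+\alpha\|x-x_0\|$ is attained only at $x_0$.
   Context: $X$ is a real normed space with origin $0_X$, dual $X^*$ and unit sphere $S_X$. For $S\subset X$: $\overline S$ is the closure, $\mathrm{bd}(S)$ the boundary, $\mathrm{int}(S)$ the interior, $\mathrm{co}(S)$ the convex hull, $S_0:=S\cup\{0_X\}$, $\mathrm{cone}(S):=\{\lambda s:\lambda\ge0,\ s\in S\}$ and $\overline{\mathrm{cone}}(S)$ is its closure. A cone is a set closed under multiplication by all $\lambda\ge0$; all cones considered are assumed non-trivial (different from $\{0_X\}$ and $X$). A cone $\mathcal{C}$ is pointed if $(-\mathcal{C})\cap\mathcal{C}=\{0_X\}$ and solid if $\mathrm{int}(\mathcal{C})\ne\emptyset$. An open cone is an open set $\mathcal{Q}\subset X$ such that $\mathcal{Q}_0$ is a (non-trivial) cone; it is convex if $\mathcal{Q}_0$ is. For non-empty $D\subset X\setminus\{0_X\}$: $D(\varepsilon):=\varepsilon D$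 if $\varepsilon>0$, and $D(0):=\mathrm{cone}(D)\setminus\{0_X\}$. $\overline{\mathcal{H}}:=\{\emptyset\ne D\subset X\setminus\{0_X\}:\overline{\mathrm{cone}}(D)\cap(-\mathcal{C})=\{0_X\}\}$. For $D\in\overline{\mathcal{H}}$, $\mathcal{G}(D)$ is the family of open convex cones $\mathcal{C}'\subset X$ with $\mathcal{C}\setminus\{0_X\}\subset\mathcal{C}'$ and $D\cap(-\mathcal{C}')=\emptyset$. $x_0\in\mathrm{He}(A,\mathcal{C},D,\varepsilon)$ (Henig $(D,\varepsilon)$-efficient point) means $x_0\in A$ and there exists $\mathcal{C}'\in\mathcal{G}(D)$ with $\overline{\mathrm{cone}}(A+D(\varepsilon)-x_0)\cap(-\mathcal{C}')=\emptyset$. A family $\mathcal{F}=\{\mathcal{C}_n:n\in\mathbb{N}\}$ of solid, closed, pointed convex cones, decreasing with respect to inclusion, approximates $\mathcal{C}$ if $\mathcal{C}=\bigcap_n\mathcal{C}_n$ and there is $n_0$ with $\mathcal{C}\setminus\{0_X\}\subset\mathrm{int}(\mathcal{C}_n)$ for all $n\ge n_0$. Such a family separates $\mathcal{C}$ from a closed cone $\mathcal{K}$ if the following implication holds: $\mathcal{C}\cap\mathcal{K}=\{0_X\}$ implies $\mathcal{C}_n\cap\mathcal{K}=\{0_X\}$ for all sufficiently large $n$. $\mathcal{S}(D(\varepsilon),x_0)$ is the set of all families that approximate $\mathcal{C}$ and separate $\mathcal{C}$ from the cone $-\overline{\mathrm{cone}}(A-x_0+D(\varepsilon))$. For a cone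 $\mathcal{C}$, $\mathcal{C}_{\wedge}:=\mathrm{co}(\mathcal{C}\cap S_X)$ and $\mathcal{C}_{\vee}:=\mathrm{co}((\mathrm{bd}(\mathcal{C})\cap S_X)_0)$. The pair of cones $(\mathcal{C},\mathcal{K})$ has the strict separation property (SSP) if $0_X\notin\overline{\mathcal{C}_{\wedge}-\mathcal{K}_{\vee}}$ (Minkowski difference). $\mathcal{C}^{\#}:=\{f\in X^*: f(x)>0\ \forall x\in\mathcal{C},\ x\neq0_X\}$ and $\mathcal{C}^{a\#}_+:=\{(f,\alpha)\in\mathcal{C}^{\#}\times(0,\infty): f(x)-\alpha\|x\|>0\ \forall x\in\mathcal{C},\ x\neq0_X\}$. *)

theory Defs
  imports "HOL-Analysis.Analysis"
begin

(* On sets, "- S" and "S - T" denote complement and set difference in HOL, so the pointwise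
   negative of a set is written "uminus ` S" and Minkowski sums and differences are written as set
   comprehensions. The library's "cone {}" is true and "cone hull S" equals
   {c *\<^sub>R x | c x. 0 \<le> c \<and> x \<in> S} (cone_hull_expl). *)

definition nontrivial_cone :: "'a::real_normed_vector set \<Rightarrow> bool" where
  "nontrivial_cone C \<longleftrightarrow> cone C \<and> C \<noteq> {} \<and> C \<noteq> {0} \<and> C \<noteq> UNIV"

definition pointed_cone :: "'a::real_normed_vector set \<Rightarrow> bool" where
  "pointed_cone C \<longleftrightarrow> nontrivial_cone C \<and> uminus ` C \<inter> C = {0}"

definition solid :: "'a::real_normed_vector set \<Rightarrow> bool" where
  "solid C \<longleftrightarrow> interior C \<noteq> {}"

definition open_convex_cone :: "'a::real_normed_vector set \<Rightarrow> bool" where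
  "open_convex_cone Q \<longleftrightarrow> open Q \<and> nontrivial_cone (insert 0 Q) \<and> convex (insert 0 Q)"

definition closed_cone_hull :: "'a::real_normed_vector set \<Rightarrow> 'a set" where
  "closed_cone_hull S = closure (cone hull S)"

(* D(eps); only used for eps \<ge> 0. *)
definition dilation :: "'a::real_normed_vector set \<Rightarrow> real \<Rightarrow> 'a set" where
  "dilation D \<epsilon> = (if \<epsilon> = 0 then cone hull D - {0} else (\<lambda>d. \<epsilon> *\<^sub>R d) ` D)"

definition sum_dilation :: "'a::real_normed_vector set \<Rightarrow> 'a set \<Rightarrow> real \<Rightarrow> 'a set" where
  "sum_dilation A D \<epsilon> = {a + d | a d. a \<in> A \<and> d \<in> dilation D \<epsilon>}"

(* The closed cone generated by A + D(eps) - x0 = A - x0 + D(eps). *)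
definition efficiency_cone ::
    "'a::real_normed_vector set \<Rightarrow> 'a set \<Rightarrow> real \<Rightarrow> 'a \<Rightarrow> 'a set" where
  "efficiency_cone A D \<epsilon> x0 = closed_cone_hull ((\<lambda>x. x - x0) ` sum_dilation A D \<epsilon>)"

definition H_bar :: "'a::real_normed_vector set \<Rightarrow> 'a set set" where
  "H_bar C = {D. D \<noteq> {} \<and> 0 \<notin> D \<and> closed_cone_hull D \<inter> uminus ` C = {0}}"

definition G_family :: "'a::real_normed_vector set \<Rightarrow> 'a set \<Rightarrow> 'a set set" where
  "G_family C D = {C'. open_convex_cone C' \<and> C - {0} \<subseteq> C' \<and> D \<inter> uminus ` C' = {}}"

definition He ::
    "'a::real_normed_vector set \<Rightarrow> 'a set \<Rightarrow> 'a set \<Rightarrow> real \<Rightarrow> 'a set" where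
  "He A C D \<epsilon> =
     {x0 \<in> A. \<exists>C' \<in> G_family C D. efficiency_cone A D \<epsilon> x0 \<inter> uminus ` C' = {}}"

definition approximates :: "(nat \<Rightarrow> 'a::real_normed_vector set) \<Rightarrow> 'a set \<Rightarrow> bool" where
  "approximates F C \<longleftrightarrow>
     (\<forall>n. solid (F n) \<and> closed (F n) \<and> pointed_cone (F n) \<and> convex (F n)) \<and>
     decseq F \<and> C = (\<Inter>n. F n) \<and> (\<exists>n0. \<forall>n\<ge>n0. C - {0} \<subseteq> interior (F n))"

definition separates ::
    "(nat \<Rightarrow> 'a::real_normed_vector set) \<Rightarrow> 'a set \<Rightarrow> 'a set \<Rightarrow> bool" where
  "separates F C K \<longleftrightarrow> (C \<inter> K = {0} \<longrightarrow> (\<exists>N. \<forall>n\<ge>N. F n \<inter> K = {0}))"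

definition S_families ::
    "'a::real_normed_vector set \<Rightarrow> 'a set \<Rightarrow> 'a set \<Rightarrow> real \<Rightarrow> 'a \<Rightarrow> (nat \<Rightarrow> 'a set) set" where
  "S_families A C D \<epsilon> x0 =
     {F. approximates F C \<and> separates F C (uminus ` efficiency_cone A D \<epsilon> x0)}"

definition wedge_base :: "'a::real_normed_vector set \<Rightarrow> 'a set" where
  "wedge_base C = convex hull (C \<inter> sphere 0 1)"

definition vee_base :: "'a::real_normed_vector set \<Rightarrow> 'a set" where
  "vee_base C = convex hull (insert 0 (frontier C \<inter> sphere 0 1))"

definition SSP :: "'a::real_normed_vector set \<Rightarrow> 'a set \<Rightarrow> bool" where
  "SSP C K \<longleftrightarrow> 0 \<notin> closure {u - v | u v. u \<in> wedge_base C \<and> v \<in> vee_base K}"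

definition quasi_interior_dual ::
    "'a::real_normed_vector set \<Rightarrow> ('a \<Rightarrow>\<^sub>L real) set" where
  "quasi_interior_dual C = {f. \<forall>x\<in>C. x \<noteq> 0 \<longrightarrow> blinfun_apply f x > 0}"

definition augmented_dual ::
    "'a::real_normed_vector set \<Rightarrow> (('a \<Rightarrow>\<^sub>L real) \<times> real) set" where
  "augmented_dual C =
     {(f, \<alpha>). f \<in> quasi_interior_dual C \<and> \<alpha> > 0 \<and>
        (\<forall>x\<in>C. x \<noteq> 0 \<longrightarrow> blinfun_apply f x - \<alpha> * norm x > 0)}"

end

theory Submission
  imports Defs
begin

text \<open>
  Separating the convex sets in the strict separation property by a functional $g$ yields
  $\alpha > 0$ such that the Bishop--Phelps cone
  $P = \{x.\ g(x) + \alpha \|x\| \le 0\}$ contains $-\mathcal{C}$ and meets the boundary of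
  $\mathcal{K} = \overline{\mathrm{cone}}(A - x_0 + D(\varepsilon))$ at most in $0$. As
  $P \setminus \{0\}$ is connected and contains points outside $\mathcal{K}$ when $x_0$ is Henig
  efficient, it misses $\mathcal{K}$ altogether, so $x_0$ is the only minimizer. Conversely,
  given $(f, \alpha)$, the open Bishop--Phelps cone $\{x.\ f(x) > \alpha \|x\|\}$ is itself a
  dilating cone for Henig efficiency, because $D \subseteq \mathcal{K}$.

  The functional $g$ comes from the Hahn--Banach theorem: a minimal sublinear functional is linear.
\<close>

section \<open>Sublinear functionals and the Hahn--Banach theorem\<close>

text \<open>Homogeneity is only an inequality, the form an infimum inherits most easily; equality
  follows by rescaling with \<open>1 / c\<close>.\<close>

definition sublinear :: "('a::real_vector \<Rightarrow> real) \<Rightarrow> bool" where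
  "sublinear q \<longleftrightarrow> (\<forall>x y. q (x + y) \<le> q x + q y) \<and> (\<forall>c x. 0 \<le> c \<longrightarrow> q (c *\<^sub>R x) \<le> c * q x)"

lemma sublinear_add: "sublinear q \<Longrightarrow> q (x + y) \<le> q x + q y"
  by (simp add: sublinear_def)

lemma sublinear_scaleR_le: "sublinear q \<Longrightarrow> 0 \<le> c \<Longrightarrow> q (c *\<^sub>R x) \<le> c * q x"
  by (simp add: sublinear_def)

lemma sublinear_zero:
  assumes "sublinear q" shows "q 0 = 0"
  using sublinear_scaleR_le[OF assms, of 0 0] sublinear_add[OF assms, of 0 0] by simp

lemma sublinear_scaleR:
  assumes "sublinear q" "0 \<le> c" shows "q (c *\<^sub>R x) = c * q x"
proof (cases "c = 0")
  case True
  then show ?thesis using sublinear_zero[OF assms(1)] by simp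
next
  case False
  with assms(2) have "c > 0" by simp
  then have "q x \<le> q (c *\<^sub>R x) / c"
    using sublinear_scaleR_le[OF assms(1), of "1 / c" "c *\<^sub>R x"] by simp
  then have "c * q x \<le> q (c *\<^sub>R x)"
    using \<open>c > 0\<close> by (simp add: field_simps)
  with sublinear_scaleR_le[OF assms, of x] show ?thesis by simp
qed

lemma sublinear_minus_ge:
  assumes "sublinear q" shows "- q (- x) \<le> q x"
  using sublinear_add[OF assms, of x "- x"] sublinear_zero[OF assms] by simp

text \<open>This serves three constructions below: the bound of a chain, the lowering of a minimal
  functional, and the majorant used for separation. The bound \<open>b\<close> keeps the infimum
  finite; a single index \<open>k\<close> dominated by the right-hand side suffices.\<close>

lemma sublinear_INF:
  assumes ne: "I \<noteq> {}"
    and lower: "\<And>i x. i \<in> I \<Longrightarrow> b x \<le> g i x"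
    and add: "\<And>i j x y. i \<in> I \<Longrightarrow> j \<in> I \<Longrightarrow> \<exists>k\<in>I. g k (x + y) \<le> g i x + g j y"
    and scale: "\<And>i c x. i \<in> I \<Longrightarrow> 0 \<le> c \<Longrightarrow> \<exists>k\<in>I. g k (c *\<^sub>R x) \<le> c * g i x"
  shows "sublinear (\<lambda>x. INF i\<in>I. g i x :: real)"
proof -
  let ?u = "\<lambda>x. INF i\<in>I. g i x"
  have le: "?u x \<le> g i x" if "i \<in> I" for i x
    using that lower by (intro cINF_lower bdd_belowI2[where m = "b x"])
  have "?u (x + y) \<le> ?u x + ?u y" for x y
  proof -
    have "?u (x + y) \<le> g i x + g j y" if "i \<in> I" "j \<in> I" for i j
      using add[OF that, of x y] le order_trans by blast
    then have "?u (x + y) - g i x \<le> ?u y" if "i \<in> I" for i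
      using that ne by (intro cINF_greatest) (force simp: algebra_simps)+
    then have "?u (x + y) - ?u y \<le> ?u x"
      using ne by (intro cINF_greatest) (force simp: algebra_simps)+
    then show ?thesis by simp
  qed
  moreover have "?u (c *\<^sub>R x) \<le> c * ?u x" if "0 \<le> c" for c x
  proof -
    have *: "?u (c *\<^sub>R x) \<le> c * g i x" if "i \<in> I" for i
      using scale[OF that \<open>0 \<le> c\<close>, of x] le order_trans by blast
    show ?thesis
    proof (cases "c = 0")
      case True
      then show ?thesis using * ne by auto
    next
      case False
      with that have "c > 0" by simp
      then have "?u (c *\<^sub>R x) / c \<le> ?u x"
        using * ne by (intro cINF_greatest) (auto simp: field_simps)
      then show ?thesis using \<open>c > 0\<close> by (simp add: field_simps)
    qed
  qed
  ultimately show ?thesis by (simp add: sublinear_def)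
qed

text \<open>Zorn's lemma for the reversed pointwise order; a nonempty chain is bounded by its
  pointwise infimum.\<close>

lemma minimal_sublinear_exists:
  assumes p: "sublinear p"
  obtains q where "sublinear q" "q \<le> p" "\<And>r. sublinear r \<Longrightarrow> r \<le> q \<Longrightarrow> r = q"
proof -
  let ?S = "{q. sublinear q \<and> q \<le> p}"
  let ?R = "relation_of (\<lambda>q r :: 'a \<Rightarrow> real. r \<le> q) ?S"
  have "partial_order_on ?S ?R"
    by (rule partial_order_on_relation_ofI) auto
  moreover have "\<exists>u\<in>?S. \<forall>q\<in>C. u \<le> q" if C: "C \<in> Chains ?R" for C
  proof (cases "C = {}")
    case True
    then show ?thesis using p by auto
  next
    case False
    have sub: "sublinear q" "q \<le> p" if "q \<in> C" for q
      using C that by (auto simp: Chains_def relation_of_def)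
    have chain: "q \<le> r \<or> r \<le> q" if "q \<in> C" "r \<in> C" for q r
      using C that by (auto simp: Chains_def relation_of_def)
    define u where "u = (\<lambda>x. INF q\<in>C. q x)"
    \<comment> \<open>This bound does not depend on \<open>q\<close>, so the infimum over the chain
      is finite.\<close>
    have lower: "- p (- x) \<le> q x" if "q \<in> C" for q x
      using sublinear_minus_ge[OF sub(1)[OF that], of x] le_funD[OF sub(2)[OF that], of "- x"]
      by linarith
    have "\<exists>k\<in>C. k (x + y) \<le> q x + r y" if qr: "q \<in> C" "r \<in> C" for q r x y
    proof -
      obtain k where k: "k \<in> C" "k \<le> q" "k \<le> r"
        using chain[OF qr] qr by blast
      then have "k (x + y) \<le> q x + r y"
        using sublinear_add[OF sub(1)[OF k(1)], of x y] le_funD[OF k(2), of x]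
          le_funD[OF k(3), of y] by linarith
      then show ?thesis using k(1) by blast
    qed
    moreover have "\<exists>k\<in>C. k (c *\<^sub>R x) \<le> c * q x" if "q \<in> C" "0 \<le> c" for q c x
      using that sublinear_scaleR_le sub(1) by blast
    ultimately have "sublinear u"
      unfolding u_def using False lower
      by (intro sublinear_INF[where b = "\<lambda>x. - p (- x)" and g = "\<lambda>q. q"]) auto
    moreover have u_le: "u \<le> q" if "q \<in> C" for q
    proof (rule le_funI)
      fix x
      show "u x \<le> q x"
        unfolding u_def using that lower by (intro cINF_lower bdd_belowI2[where m = "- p (- x)"])
    qed
    moreover have "u \<le> p"
    proof -
      obtain q where "q \<in> C" using False by blast
      then show ?thesis using order_trans[OF u_le sub(2)] by simp
    qed
    ultimately show ?thesis by (intro bexI[of _ u]) simp_all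
  qed
  ultimately have "\<exists>q\<in>?S. \<forall>r\<in>?S. r \<le> q \<longrightarrow> r = q"
    by (intro predicate_Zorn) auto
  then obtain q where "q \<in> ?S" "\<forall>r\<in>?S. r \<le> q \<longrightarrow> r = q"
    by blast
  \<comment> \<open>Anything below \<open>q\<close> is below \<open>p\<close>, so minimality within
    \<open>?S\<close> is minimality among all sublinear functionals.\<close>
  then show ?thesis
    by (intro that[of q]) (auto intro: order_trans[of _ q p])
qed

text \<open>A minimal sublinear \<open>q\<close> is superadditive, since otherwise it could be
  lowered. It is then additive, hence odd, and homogeneity extends to negative scalars.\<close>

theorem Hahn_Banach_sublinear:
  fixes p :: "'a::real_vector \<Rightarrow> real"
  assumes "sublinear p"
  obtains f where "linear f" "\<And>x. f x \<le> p x"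
proof -
  obtain q where q: "sublinear q" "q \<le> p" and min: "\<And>r. sublinear r \<Longrightarrow> r \<le> q \<Longrightarrow> r = q"
    using minimal_sublinear_exists[OF assms] by metis
  have super: "q x + q y \<le> q (x + y)" for x y
  proof -
    \<comment> \<open>The largest sublinear functional below \<open>q\<close> whose value at \<open>- y\<close> is at most \<open>- q y\<close>.\<close>
    define g where "g = (\<lambda>t x. q (x + t *\<^sub>R y) - t * q y)"
    define r where "r = (\<lambda>x. INF t\<in>{0..}. g t x)"
    have lower: "- q (- x) \<le> g t x" if "t \<in> {0..}" for t x
      using sublinear_add[OF q(1), of "x + t *\<^sub>R y" "- x"] sublinear_scaleR[OF q(1), of t y] that
      by (simp add: g_def)
    have "\<exists>k\<in>{0..}. g k (x + z) \<le> g s x + g t z" if "s \<in> {0..}" "t \<in> {0..}" for s t x z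
      using that sublinear_add[OF q(1), of "x + s *\<^sub>R y" "z + t *\<^sub>R y"]
      by (intro bexI[of _ "s + t"]) (auto simp: g_def algebra_simps)
    moreover have "\<exists>k\<in>{0..}. g k (c *\<^sub>R x) \<le> c * g t x" if "t \<in> {0..}" "0 \<le> c" for t c x
      using that sublinear_scaleR_le[OF q(1), of c "x + t *\<^sub>R y"]
      by (intro bexI[of _ "c * t"]) (auto simp: g_def algebra_simps)
    ultimately have "sublinear r"
      unfolding r_def using lower by (intro sublinear_INF[where b = "\<lambda>x. - q (- x)"]) auto
    moreover have r_le: "r x \<le> g t x" if "0 \<le> t" for t x
      unfolding r_def using that lower by (intro cINF_lower bdd_belowI2[where m = "- q (- x)"]) auto
    moreover have "r \<le> q"
      using r_le[of 0] by (simp add: g_def le_fun_def)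
    \<comment> \<open>Minimality forces \<open>r = q\<close>; the index \<open>t = 1\<close> then
      gives \<open>q x \<le> q (x + y) - q y\<close>.\<close>
    ultimately have "q x \<le> g 1 x"
      using min[of r] by (metis zero_le_one)
    then show ?thesis by (simp add: g_def)
  qed
  have add: "q (x + y) = q x + q y" for x y
    using super[of x y] sublinear_add[OF q(1), of x y] by linarith
  have minus: "q (- x) = - q x" for x
    using add[of x "- x"] sublinear_zero[OF q(1)] by simp
  have "q (c *\<^sub>R x) = c * q x" for c x
    using sublinear_scaleR[OF q(1), of c x] sublinear_scaleR[OF q(1), of "- c" x]
      minus[of "c *\<^sub>R x"] by (cases "0 \<le> c") auto
  with add have "linear q" by (intro linearI) auto
  then show ?thesis using that q(2) by (auto simp: le_fun_def)
qed

section \<open>Separating a convex set from the origin\<close>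

theorem separating_functional_zero_convex:
  fixes M :: "'a::real_normed_vector set"
  assumes "convex M" "M \<noteq> {}" "0 \<notin> closure M"
  obtains f :: "'a \<Rightarrow>\<^sub>L real" and r where "r > 0" "\<And>m. m \<in> M \<Longrightarrow> r \<le> blinfun_apply f m"
proof -
  obtain r where r: "r > 0" "\<And>m. m \<in> M \<Longrightarrow> r \<le> norm m"
    using assms(3) by (auto simp: closure_approachable not_less)
  \<comment> \<open>A linear \<open>f\<close> has \<open>f \<le> norm\<close> and \<open>f \<ge> r\<close> on \<open>M\<close> iff \<open>f \<le> p\<close>.\<close>
  define g where "g = (\<lambda>(t, m) x :: 'a. norm (x + t *\<^sub>R m) - t * r)"
  define p where "p = (\<lambda>x. INF i\<in>{0..} \<times> M. g i x)"
  have lower: "- norm x \<le> g i x" if im: "i \<in> {0..} \<times> M" for i x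
  proof -
    obtain t m where i: "i = (t, m)" "t \<ge> 0" "m \<in> M" using im by auto
    have "t * r \<le> norm (t *\<^sub>R m)"
      using i r(2) by (simp add: mult_left_mono)
    also have "\<dots> \<le> norm (x + t *\<^sub>R m) + norm x"
      using norm_triangle_ineq4[of "x + t *\<^sub>R m" x] by simp
    finally show ?thesis by (simp add: i g_def)
  qed
  have "\<exists>k\<in>{0..} \<times> M. g k (x + y) \<le> g i x + g j y"
    if ij: "i \<in> {0..} \<times> M" "j \<in> {0..} \<times> M" for i j x y
  proof -
    obtain t m where i: "i = (t, m)" "t \<ge> 0" "m \<in> M" using ij by auto
    obtain s n where j: "j = (s, n)" "s \<ge> 0" "n \<in> M" using ij by auto
    \<comment> \<open>The weighted mean of \<open>m\<close> and \<open>n\<close>, where convexity of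
      \<open>M\<close> enters; for zero total weight any member of \<open>M\<close> works.\<close>
    obtain k where k: "k \<in> M" "(t + s) *\<^sub>R k = t *\<^sub>R m + s *\<^sub>R n"
    proof (cases "t + s = 0")
      case True
      then have "t = 0" "s = 0" using i j by auto
      then show ?thesis using that[of m] i by simp
    next
      case False
      then have "t + s > 0" using i j by simp
      then have "(t / (t + s)) *\<^sub>R m + (s / (t + s)) *\<^sub>R n \<in> M"
        using i j by (intro convexD[OF assms(1)]) (auto simp: add_divide_distrib[symmetric])
      then show ?thesis
        using that \<open>t + s > 0\<close> by (force simp: scaleR_add_right)
    qed
    have "g (t + s, k) (x + y) \<le> g i x + g j y"
      using norm_triangle_ineq[of "x + t *\<^sub>R m" "y + s *\<^sub>R n"] k(2)
      by (simp add: g_def i j algebra_simps)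
    then show ?thesis using i j k(1) by (intro bexI[of _ "(t + s, k)"]) auto
  qed
  moreover have "\<exists>k\<in>{0..} \<times> M. g k (c *\<^sub>R x) \<le> c * g i x"
    if ic: "i \<in> {0..} \<times> M" "0 \<le> c" for i c x
  proof -
    obtain t m where i: "i = (t, m)" "t \<ge> 0" "m \<in> M" using ic by auto
    have "norm (c *\<^sub>R x + (c * t) *\<^sub>R m) = c * norm (x + t *\<^sub>R m)"
      using ic(2) by (metis abs_of_nonneg norm_scaleR scaleR_add_right scaleR_scaleR)
    then have "g (c * t, m) (c *\<^sub>R x) \<le> c * g i x"
      by (simp add: g_def i algebra_simps)
    then show ?thesis using i ic by (intro bexI[of _ "(c * t, m)"]) auto
  qed
  ultimately have "sublinear p"
    unfolding p_def using lower assms(2)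
    by (intro sublinear_INF[where b = "\<lambda>x. - norm x"]) auto
  then obtain f where f: "linear f" "\<And>x. f x \<le> p x"
    using Hahn_Banach_sublinear by blast
  have p_le: "p x \<le> norm (x + t *\<^sub>R m) - t * r" if "t \<ge> 0" "m \<in> M" for t m x
  proof -
    have "p x \<le> g (t, m) x"
      unfolding p_def using that lower by (intro cINF_lower bdd_belowI2[where m = "- norm x"]) auto
    then show ?thesis by (simp add: g_def)
  qed
  have f_le: "f x \<le> norm x" for x
    using f(2)[of x] p_le[of 0 _ x] assms(2) by fastforce
  have "norm (f x) \<le> norm x * 1" for x
    using f_le[of x] f_le[of "- x"] by (simp add: linear_neg[OF f(1)] abs_le_iff)
  then have "bounded_linear f"
    using f(1) by (intro bounded_linear.intro bounded_linear_axioms.intro) blast+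
  \<comment> \<open>At \<open>x = - m\<close> and \<open>t = 1\<close> the norm term vanishes,
    leaving \<open>f (- m) \<le> - r\<close>.\<close>
  moreover have "r \<le> f m" if "m \<in> M" for m
    using f(2)[of "- m"] p_le[of 1 m "- m"] that by (simp add: linear_neg[OF f(1)])
  ultimately show ?thesis
    using that[of r "Blinfun f"] r(1) by (simp add: bounded_linear_Blinfun_apply)
qed

section \<open>Bishop--Phelps cones and efficiency\<close>

text \<open>The set is convex even without its apex: \<open>f\<close> is negative on it, so no
  convex combination can vanish.\<close>

lemma connected_Bishop_Phelps_cone:
  fixes f :: "'a::real_normed_vector \<Rightarrow>\<^sub>L real"
  assumes "\<alpha> > 0"
  shows "connected {x. x \<noteq> 0 \<and> blinfun_apply f x + \<alpha> * norm x \<le> 0}" (is "connected ?P")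
proof (rule convex_connected, rule convexI)
  fix x y :: 'a and u v :: real
  assume x: "x \<in> ?P" and y: "y \<in> ?P" and uv: "0 \<le> u" "0 \<le> v" "u + v = 1"
  have neg: "blinfun_apply f z < 0" if "z \<in> ?P" for z
  proof -
    have "0 < \<alpha> * norm z" using that assms by simp
    then show ?thesis using that by simp
  qed
  let ?z = "u *\<^sub>R x + v *\<^sub>R y"
  have fz: "blinfun_apply f ?z = u * blinfun_apply f x + v * blinfun_apply f y"
    by (simp add: blinfun.add_right blinfun.scaleR_right)
  have "blinfun_apply f ?z < 0"
  proof (cases "u = 0")
    case True
    then show ?thesis using fz uv neg[OF y] by simp
  next
    case False
    then have "u * blinfun_apply f x < 0" "v * blinfun_apply f y \<le> 0"
      using uv neg[OF x] neg[OF y] by (simp_all add: mult_less_0_iff mult_le_0_iff)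
    then show ?thesis using fz by linarith
  qed
  then have "?z \<noteq> 0" by (metis blinfun.zero_right less_irrefl)
  moreover have "\<alpha> * norm ?z \<le> \<alpha> * (u * norm x + v * norm y)"
    using norm_triangle_ineq[of "u *\<^sub>R x" "v *\<^sub>R y"] assms uv by simp
  moreover have "u * (blinfun_apply f x + \<alpha> * norm x) + v * (blinfun_apply f y + \<alpha> * norm y) \<le> 0"
    using x y uv by (intro add_nonpos_nonpos) (simp_all add: mult_nonneg_nonpos)
  ultimately show "?z \<in> ?P" using fz by (simp add: algebra_simps)
qed

text \<open>Convexity is the triangle inequality. The point \<open>c\<close> witnesses
  non-triviality: it lies in the cone and \<open>- c\<close> does not.\<close>

lemma open_convex_cone_Bishop_Phelps:
  fixes f :: "'a::real_normed_vector \<Rightarrow>\<^sub>L real"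
  assumes "0 \<le> \<alpha>" "\<alpha> * norm c < blinfun_apply f c"
  shows "open_convex_cone {x. \<alpha> * norm x < blinfun_apply f x}" (is "open_convex_cone ?Q")
proof -
  have c0: "c \<noteq> 0" using assms(2) by auto
  have fc: "0 < blinfun_apply f c"
    using assms by (meson mult_nonneg_nonneg norm_ge_zero order_le_less_trans)
  have "open ?Q" by (intro open_Collect_less continuous_intros)
  moreover have cone: "cone (insert 0 ?Q)"
    unfolding cone_def
  proof (intro ballI allI impI)
    fix x and t :: real assume x: "x \<in> insert 0 ?Q" "0 \<le> t"
    show "t *\<^sub>R x \<in> insert 0 ?Q"
    proof (cases "x = 0 \<or> t = 0")
      case False
      then have "t * (\<alpha> * norm x) < t * blinfun_apply f x" using x by simp
      then show ?thesis using x(2) by (simp add: blinfun.scaleR_right algebra_simps)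
    qed auto
  qed
  moreover have "insert 0 ?Q \<noteq> {0}" using c0 assms(2) by auto
  moreover have "- c \<notin> insert 0 ?Q"
  proof -
    have "\<alpha> * norm (- c) \<ge> 0" using assms(1) by simp
    then show ?thesis using c0 fc by (simp add: blinfun.minus_right)
  qed
  moreover have "convex (insert 0 ?Q)"
  proof -
    have "x + y \<in> insert 0 ?Q" if "x \<in> insert 0 ?Q" "y \<in> insert 0 ?Q" for x y
    proof (cases "x = 0 \<or> y = 0")
      case False
      have "\<alpha> * norm (x + y) \<le> \<alpha> * norm x + \<alpha> * norm y"
        using mult_left_mono[OF norm_triangle_ineq[of x y] assms(1)] by (simp add: algebra_simps)
      then show ?thesis using that False by (simp add: blinfun.add_right)
    qed (use that in auto)
    then show ?thesis using cone convex_cone[of "insert 0 ?Q"] unfolding cone_def by blast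
  qed
  ultimately show ?thesis
    unfolding open_convex_cone_def nontrivial_cone_def by blast
qed

section \<open>Frontiers of cones and the efficiency cone\<close>

text \<open>Scaling by \<open>c\<close> maps both \<open>K\<close> and its complement into
  themselves, hence also their closures. This allows frontier points to be normalized to the unit
  sphere.\<close>

lemma frontier_cone_scaleR:
  fixes x :: "'a::real_normed_vector"
  assumes K: "cone K" and c: "0 < c" and x: "x \<in> frontier K"
  shows "c *\<^sub>R x \<in> frontier K"
proof -
  have *: "c *\<^sub>R x \<in> closure S" if "x \<in> closure S" "(*\<^sub>R) c ` S \<subseteq> S" for S
    using closure_mono[OF that(2)] that(1) by (auto simp: closure_scaleR[symmetric])
  have "(*\<^sub>R) c ` K \<subseteq> K" using K c by (auto simp: cone_def)
  moreover have "y \<in> K" if "c *\<^sub>R y \<in> K" for y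
  proof -
    have "(1 / c) *\<^sub>R (c *\<^sub>R y) \<in> K"
      using K c that unfolding cone_def by (meson less_imp_le divide_nonneg_pos zero_le_one)
    then show ?thesis using c by simp
  qed
  then have "(*\<^sub>R) c ` (- K) \<subseteq> - K" by blast
  ultimately show ?thesis
    using x * by (simp add: frontier_closures)
qed

text \<open>The set \<open>?N\<close> is closed and stable under nonnegative scaling, which suffices
  because \<open>cone hull\<close> adds only rays. Strict positivity could be lost in the
  closure.\<close>

lemma efficiency_cone_nonneg:
  fixes f :: "'a::real_normed_vector \<Rightarrow>\<^sub>L real"
  assumes "\<And>x. x \<in> sum_dilation A D \<epsilon> \<Longrightarrow> 0 \<le> blinfun_apply f (x - x0) + \<alpha> * norm (x - x0)"
    and "y \<in> efficiency_cone A D \<epsilon> x0"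
  shows "0 \<le> blinfun_apply f y + \<alpha> * norm y"
proof -
  let ?N = "{y. 0 \<le> blinfun_apply f y + \<alpha> * norm y}"
  have scale: "c *\<^sub>R z \<in> ?N" if "0 \<le> c" "z \<in> ?N" for c z
  proof -
    have "0 \<le> c * (blinfun_apply f z + \<alpha> * norm z)" using that by simp
    then show ?thesis using that(1) by (simp add: blinfun.scaleR_right algebra_simps)
  qed
  have "c *\<^sub>R (x - x0) \<in> ?N" if "0 \<le> c" "x \<in> sum_dilation A D \<epsilon>" for c x
    using assms(1) that by (intro scale) auto
  then have "cone hull ((\<lambda>x. x - x0) ` sum_dilation A D \<epsilon>) \<subseteq> ?N"
    by (auto simp: cone_hull_expl)
  moreover have "closed ?N" by (intro closed_Collect_le continuous_intros)
  ultimately show ?thesis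
    using assms(2) closure_minimal unfolding efficiency_cone_def closed_cone_hull_def by blast
qed

lemma sum_dilation_diff_mem_efficiency_cone:
  assumes "x \<in> sum_dilation A D \<epsilon>" shows "x - x0 \<in> efficiency_cone A D \<epsilon> x0"
  unfolding efficiency_cone_def closed_cone_hull_def
  using assms by (intro subsetD[OF closure_subset] hull_inc) auto

lemma cone_efficiency_cone: "cone (efficiency_cone A D \<epsilon> x0)"
  unfolding efficiency_cone_def closed_cone_hull_def by (intro cone_closure cone_cone_hull)

text \<open>Taking \<open>x0\<close> itself from \<open>A\<close> puts
  \<open>dilation D \<epsilon>\<close> into the cone, and each \<open>d\<close> is a nonnegative
  multiple of an element of it. Thus a cone whose negative misses the efficiency cone also satisfies
  the condition on \<open>D\<close> in \<open>G_family\<close>.\<close>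

lemma subset_efficiency_cone:
  assumes "x0 \<in> A" "0 \<le> \<epsilon>" "0 \<notin> D"
  shows "D \<subseteq> efficiency_cone A D \<epsilon> x0"
proof
  fix d assume d: "d \<in> D"
  obtain c where c: "0 \<le> c" "d \<in> (\<lambda>e. c *\<^sub>R e) ` dilation D \<epsilon>"
  proof (cases "\<epsilon> = 0")
    case True
    then have "d \<in> dilation D \<epsilon>" using d assms(3) by (auto simp: dilation_def hull_inc)
    then show ?thesis using that[of 1] by simp
  next
    case False
    then have "d = (1 / \<epsilon>) *\<^sub>R (\<epsilon> *\<^sub>R d)" "\<epsilon> *\<^sub>R d \<in> dilation D \<epsilon>"
      using d by (auto simp: dilation_def)
    then show ?thesis using that[of "1 / \<epsilon>"] assms(2)
      by (metis divide_nonneg_nonneg image_eqI zero_le_one)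
  qed
  then obtain e where e: "d = c *\<^sub>R e" "e \<in> dilation D \<epsilon>" by blast
  have "x0 + e \<in> sum_dilation A D \<epsilon>" using assms(1) e(2) by (auto simp: sum_dilation_def)
  then have "e \<in> efficiency_cone A D \<epsilon> x0"
    using sum_dilation_diff_mem_efficiency_cone[of "x0 + e" A D \<epsilon> x0] by simp
  then show "d \<in> efficiency_cone A D \<epsilon> x0"
    using cone_efficiency_cone c(1) e(1) unfolding cone_def by blast
qed

text \<open>
  The constant \<open>\<alpha>\<close> lies strictly between \<open>- Inf g\<close> over the base of \<open>K\<close> and
  \<open>- Sup g\<close> over the base of \<open>- C\<close>; it is positive because the former base contains \<open>0\<close>.
\<close>
lemma SSP_imp_augmented_dual:
  fixes C K :: "'a::real_normed_vector set"
  assumes C: "cone C" and c: "c \<in> C" "c \<noteq> 0" and K: "cone K" and ssp: "SSP (uminus ` C) K"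
    and disj: "K \<inter> uminus ` C \<subseteq> {0}"
  obtains g \<alpha> where "(g, \<alpha>) \<in> augmented_dual C"
    "\<And>x. x \<in> K \<Longrightarrow> x \<noteq> 0 \<Longrightarrow> 0 < blinfun_apply g x + \<alpha> * norm x"
proof -
  define U V where "U = wedge_base (uminus ` C)" and "V = vee_base K"
  have U: "- ((1 / norm x) *\<^sub>R x) \<in> U" if "x \<in> C" "x \<noteq> 0" for x
    using that C unfolding U_def wedge_base_def cone_def by (intro hull_inc) auto
  have V0: "0 \<in> V" unfolding V_def vee_base_def by (intro hull_inc) auto
  have "convex U" "convex V" unfolding U_def V_def wedge_base_def vee_base_def by auto
  define M where "M = {u - v | u v. u \<in> U \<and> v \<in> V}"
  have "M = (\<Union>u\<in>U. \<Union>v\<in>V. {u - v})" unfolding M_def by blast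
  then have "convex M"
    using convex_differences[OF \<open>convex U\<close> \<open>convex V\<close>] by (simp only:)
  moreover have "M \<noteq> {}" using U[OF c] V0 unfolding M_def by blast
  moreover have "0 \<notin> closure M" using ssp unfolding SSP_def M_def U_def V_def .
  ultimately obtain f :: "'a \<Rightarrow>\<^sub>L real" and r where r: "r > 0"
    and f: "\<And>m. m \<in> M \<Longrightarrow> r \<le> blinfun_apply f m"
    using separating_functional_zero_convex by blast
  \<comment> \<open>The sign change makes the functional positive on \<open>C\<close> instead of on
    \<open>- C\<close>.\<close>
  define g where "g = - f"
  have uv: "blinfun_apply g u + r \<le> blinfun_apply g v" if "u \<in> U" "v \<in> V" for u v
  proof -
    have "u - v \<in> M" unfolding M_def using that by blast
    from f[OF this] show ?thesis by (simp add: g_def blinfun.diff_right blinfun.minus_left)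
  qed
  define s where "s = (INF v\<in>V. blinfun_apply g v)"
  have "bdd_below (blinfun_apply g ` V)"
    using uv[OF U[OF c]] by (rule bdd_belowI2)
  then have s_le: "s \<le> blinfun_apply g v" if "v \<in> V" for v
    unfolding s_def using that by (rule cINF_lower)
  have s_ge: "blinfun_apply g u + r \<le> s" if "u \<in> U" for u
    unfolding s_def using that uv V0 by (intro cINF_greatest) auto
  \<comment> \<open>With this choice \<open>g\<close> is at most \<open>- \<alpha> - r / 2\<close>
    on \<open>U\<close> and at least \<open>- \<alpha> + r / 2\<close> on \<open>V\<close>, so both
    estimates below are strict.\<close>
  define \<alpha> where "\<alpha> = r / 2 - s"
  have \<alpha>: "\<alpha> > 0" using s_le[OF V0] r by (simp add: \<alpha>_def)
  have gC: "\<alpha> * norm x < blinfun_apply g x" if "x \<in> C" "x \<noteq> 0" for x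
  proof -
    have "\<alpha> < blinfun_apply g x / norm x"
      using s_ge[OF U[OF that]] r
      by (simp add: \<alpha>_def blinfun.minus_right blinfun.scaleR_right)
    then show ?thesis using that(2) by (simp add: field_simps)
  qed
  have gF: "0 < blinfun_apply g x + \<alpha> * norm x" if "x \<in> frontier K" "x \<noteq> 0" for x
  proof -
    have "(1 / norm x) *\<^sub>R x \<in> frontier K"
      using that by (intro frontier_cone_scaleR[OF K]) auto
    then have "(1 / norm x) *\<^sub>R x \<in> V"
      using that(2) unfolding V_def vee_base_def by (intro hull_inc) auto
    from s_le[OF this] have "- \<alpha> < blinfun_apply g x / norm x"
      using r by (simp add: \<alpha>_def blinfun.scaleR_right)
    then show ?thesis using that(2) by (simp add: field_simps)
  qed
  let ?P = "{x. x \<noteq> 0 \<and> blinfun_apply g x + \<alpha> * norm x \<le> 0}"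
  \<comment> \<open>Here \<open>disj\<close> enters: \<open>?P\<close> has a point outside
    \<open>K\<close>, so if it also met \<open>K\<close> it would, being connected, cross the
    frontier of \<open>K\<close>.\<close>
  have "- c \<in> ?P" "- c \<notin> K" using gC[OF c] c disj by (auto simp: blinfun.minus_right)
  then have "?P - K \<noteq> {}" by blast
  moreover have "?P \<inter> frontier K = {}" using gF by (auto simp: not_le[symmetric])
  ultimately have "?P \<inter> K = {}"
    using connected_Int_frontier[OF connected_Bishop_Phelps_cone[OF \<alpha>]] by blast
  moreover have "0 < blinfun_apply g x" if "x \<in> C" "x \<noteq> 0" for x
    using gC[OF that] \<alpha> by (meson mult_nonneg_nonneg less_imp_le norm_ge_zero order_le_less_trans)
  ultimately show ?thesis
    by (intro that[of g \<alpha>])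
      (use \<alpha> gC in \<open>auto simp: augmented_dual_def quasi_interior_dual_def not_le[symmetric]\<close>)
qed

section \<open>Unique minimizers and Henig efficiency\<close>

text \<open>If \<open>x0\<close> is a minimizer, \<open>h\<close> is nonnegative on
  \<open>S\<close>, so any other point of \<open>S\<close> without positive value would be a second
  minimizer. This turns attainment only at \<open>x0\<close> into a sign condition.\<close>

lemma is_arg_min_unique_zero_iff:
  fixes h :: "'a \<Rightarrow> real"
  assumes "h x0 = 0"
  shows "(\<forall>x. is_arg_min h (\<lambda>x. x \<in> S \<union> {x0}) x \<longleftrightarrow> x = x0) \<longleftrightarrow> (\<forall>x\<in>S. x \<noteq> x0 \<longrightarrow> 0 < h x)"
    (is "?L \<longleftrightarrow> ?R")
proof
  assume L: ?L
  then have ge: "0 \<le> h x" if "x \<in> S" for x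
    using that assms by (force simp: is_arg_min_def not_less)
  show ?R
  proof (intro ballI impI)
    fix x assume x: "x \<in> S" "x \<noteq> x0"
    show "0 < h x"
    proof (rule ccontr)
      assume "\<not> 0 < h x"
      then have "is_arg_min h (\<lambda>x. x \<in> S \<union> {x0}) x"
        using ge x(1) assms by (force simp: is_arg_min_def)
      with L x(2) show False by blast
    qed
  qed
next
  assume R: ?R
  show ?L
  proof
    fix x
    have "h x0 < h x" if "x \<in> S" "x \<noteq> x0" for x
      using R that assms by simp
    then show "is_arg_min h (\<lambda>x. x \<in> S \<union> {x0}) x \<longleftrightarrow> x = x0"
      unfolding is_arg_min_def using order.asym by blast
  qed
qed

theorem corollary4p6:
  fixes C A D :: "'a::real_normed_vector set" and x0 :: 'a and \<epsilon> :: real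
  assumes "closed C" and "convex C" and "pointed_cone C"
    and "x0 \<in> A" and "\<epsilon> \<ge> 0" and "D \<in> H_bar C"
    and "SSP (uminus ` C) (efficiency_cone A D \<epsilon> x0)"
    and "S_families A C D \<epsilon> x0 \<noteq> {}"
  shows "x0 \<in> He A C D \<epsilon> \<longleftrightarrow>
    (\<exists>(f, \<alpha>) \<in> augmented_dual C.
       \<forall>x. is_arg_min (\<lambda>x. blinfun_apply f (x - x0) + \<alpha> * norm (x - x0))
              (\<lambda>x. x \<in> sum_dilation A D \<epsilon> \<union> {x0}) x \<longleftrightarrow> x = x0)"
proof -
  let ?K = "efficiency_cone A D \<epsilon> x0"
  have min_iff: "(\<forall>x. is_arg_min (\<lambda>x. blinfun_apply f (x - x0) + \<alpha> * norm (x - x0))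
        (\<lambda>x. x \<in> sum_dilation A D \<epsilon> \<union> {x0}) x \<longleftrightarrow> x = x0) \<longleftrightarrow>
      (\<forall>x\<in>sum_dilation A D \<epsilon>. x \<noteq> x0 \<longrightarrow> 0 < blinfun_apply f (x - x0) + \<alpha> * norm (x - x0))"
    for f :: "'a \<Rightarrow>\<^sub>L real" and \<alpha>
    by (rule is_arg_min_unique_zero_iff) simp
  have cone: "cone C" and "C \<noteq> {}" "C \<noteq> {0}"
    using assms(3) by (auto simp: pointed_cone_def nontrivial_cone_def)
  then obtain c where c: "c \<in> C" "c \<noteq> 0" by blast
  show ?thesis unfolding min_iff
  proof
    assume "x0 \<in> He A C D \<epsilon>"
    then obtain Q where Q: "Q \<in> G_family C D" "?K \<inter> uminus ` Q = {}"
      by (auto simp: He_def)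
    have "C - {0} \<subseteq> Q" using Q(1) by (auto simp: G_family_def)
    then have "?K \<inter> uminus ` C \<subseteq> {0}" using Q(2) by fastforce
    then obtain g \<alpha> where "(g, \<alpha>) \<in> augmented_dual C"
      and "\<And>x. x \<in> ?K \<Longrightarrow> x \<noteq> 0 \<Longrightarrow> 0 < blinfun_apply g x + \<alpha> * norm x"
      using SSP_imp_augmented_dual[OF cone c cone_efficiency_cone assms(7)] by metis
    then show "\<exists>(f, \<alpha>) \<in> augmented_dual C. \<forall>x\<in>sum_dilation A D \<epsilon>.
        x \<noteq> x0 \<longrightarrow> 0 < blinfun_apply f (x - x0) + \<alpha> * norm (x - x0)"
      by (intro bexI[of _ "(g, \<alpha>)"]) (simp_all add: sum_dilation_diff_mem_efficiency_cone)
  next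
    assume "\<exists>(f, \<alpha>) \<in> augmented_dual C. \<forall>x\<in>sum_dilation A D \<epsilon>.
        x \<noteq> x0 \<longrightarrow> 0 < blinfun_apply f (x - x0) + \<alpha> * norm (x - x0)"
    then obtain f \<alpha> where f: "(f, \<alpha>) \<in> augmented_dual C"
      and pos: "\<And>x. x \<in> sum_dilation A D \<epsilon> \<Longrightarrow> x \<noteq> x0 \<Longrightarrow>
        0 < blinfun_apply f (x - x0) + \<alpha> * norm (x - x0)" by blast
    \<comment> \<open>The point \<open>x0\<close> may itself lie in
      \<open>sum_dilation A D \<epsilon>\<close>, where the value is zero.\<close>
    have nonneg: "0 \<le> blinfun_apply f (x - x0) + \<alpha> * norm (x - x0)" if "x \<in> sum_dilation A D \<epsilon>" for x
      using pos[OF that] by (cases "x = x0") auto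
    define Q where "Q = {x. \<alpha> * norm x < blinfun_apply f x}"
    \<comment> \<open>On the negative of \<open>Q\<close> the sum of \<open>f\<close> and \<alpha>
      times the norm is negative, whereas on \<open>?K\<close> it is nonnegative.\<close>
    have disj: "?K \<inter> uminus ` Q = {}"
      using efficiency_cone_nonneg[OF nonneg] by (fastforce simp: Q_def blinfun.minus_right)
    have \<alpha>: "\<alpha> > 0" and fC: "\<And>x. x \<in> C \<Longrightarrow> x \<noteq> 0 \<Longrightarrow> \<alpha> * norm x < blinfun_apply f x"
      using f by (auto simp: augmented_dual_def)
    have "open_convex_cone Q"
      unfolding Q_def using \<alpha> fC[OF c] by (intro open_convex_cone_Bishop_Phelps) auto
    moreover have "D \<subseteq> ?K"
      using assms(4,5,6) by (intro subset_efficiency_cone) (auto simp: H_bar_def)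
    ultimately have "Q \<in> G_family C D"
      using disj fC by (auto simp: G_family_def Q_def)
    with disj assms(4) show "x0 \<in> He A C D \<epsilon>" by (auto simp: He_def)
  qed
qed

end
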